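(* Let $k\ge 3$ be odd and let $N$ be the largest odd number such that $N\le k/3$. Then there is a minion homomorphism from $\mathrm{Pol}(\mathbf C_k,\mathbf K_3)$ to $\mathcal Z_{\le N}$.
   Context: Graphs are loopless. $\mathbf C_m$ is the $m$-cycle with vertex set $\{0,1,\dots,m-1\}$, two vertices adjacent iff they differ by exactly $1$ modulo $m$; $\mathbf K_3=\mathbf C_3$. The $n$-th direct power $\mathbf G^n$ has vertex set $V(G)^n$, with $((u_1,\dots,u_n),(v_1,\dots,v_n))$ an edge iff $(u_i,v_i)\in E(G)$ for all $i$. An $n$-ary polymorphism from $\mathbf G$ to $\mathbf H$ is a graph homomorphism $\mathbf G^n\to\mathbf H$; $\mathrm{Pol}(\mathbf G,\mathbf H)$ is the set of all polymorphisms of all arities $n\ge1$. An $n$-ary function $f\colon A^n\to B$ is a minor of an $m$-ary $g\colon A^m\to B$ given by $\pi\colon\{1,\dots,m\}\to\{1,\dots,n\}$ if $f(x_1,\dots,x_n)=g(x_{\pi(1)},\dots,x_{\pi(m)})$ for all $x_i\in A$. A (function) minion on $(A,B)$ is a nonempty set of functions $A^n\to B$ ($n\ge1$) closed under taking minors. A minion homomorphism $\xi\colon\mathcal M\to\mathcal N$ is a map that preserves arities and satisfies $\xi(g)(x_{\pi(1)},\dots,x_{\pi(m)})=\xi(g(x_{\pi(1)},\dots,x_{\pi(m)}))$ for all $m$-ary $g\in\mathcal M$ and all $\pi\colon\{1,\dots,m\}\to\{1,\dots,n\}$ (i.e., $\xi$ maps the minor of $g$ given by $\pi$ to the minor of $\xi(g)$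 given by $\pi$). For odd $N$, $\mathcal Z_{\le N}$ is the set of all functions $f\colon\mathbb Z^n\to\mathbb Z$ ($n\ge1$) of the form $f(x_1,\dots,x_n)=c_1x_1+\dots+c_nx_n$ with $c_i\in\mathbb Z$, $\sum_i|c_i|\le N$, and $\sum_i c_i$ odd. *)

theory Defs
  imports
    Complex_Main
    "HOL-Library.FuncSet"
    "HOL-Number_Theory.Cong"
    "Graph_Theory.Pair_Digraph"
begin

section \<open>Tuples and functions of finite arity\<close>

text \<open>
  An \<open>n\<close>-tuple over \<open>A\<close> is an extensional function on \<open>{1..n}\<close>. A function \<open>A^n \<rightarrow> B\<close> is
  represented by the pair of its arity \<open>n\<close> and an extensional function on the \<open>n\<close>-tuples, so that
  equality of such pairs is equality of finitary functions.
\<close>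

type_synonym 'a tuple = "nat \<Rightarrow> 'a"

type_synonym ('a, 'b) fin_fun = "nat \<times> ('a tuple \<Rightarrow> 'b)"

definition tuples :: "nat \<Rightarrow> 'a set \<Rightarrow> 'a tuple set" where
  "tuples n A = {1..n} \<rightarrow>\<^sub>E A"

definition fin_funs :: "'a set \<Rightarrow> 'b set \<Rightarrow> ('a, 'b) fin_fun set" where
  "fin_funs A B = {(n, f). n \<ge> 1 \<and> f \<in> tuples n A \<rightarrow>\<^sub>E B}"

text \<open>
  The \<open>n\<close>-ary minor of the \<open>m\<close>-ary function \<open>g\<close> given by \<open>\<pi> : {1..m} \<rightarrow> {1..n}\<close>, where \<open>m = fst g\<close>:
  it maps \<open>(x_1, ..., x_n)\<close> to \<open>g (x_(\<pi> 1), ..., x_(\<pi> m))\<close>.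
\<close>

definition minor :: "'a set \<Rightarrow> nat \<Rightarrow> (nat \<Rightarrow> nat) \<Rightarrow> ('a, 'b) fin_fun \<Rightarrow> ('a, 'b) fin_fun" where
  "minor A n \<pi> g = (n, \<lambda>x \<in> tuples n A. snd g (\<lambda>i \<in> {1..fst g}. x (\<pi> i)))"

section \<open>Minions\<close>

locale minion =
  fixes A :: "'a set" and B :: "'b set" and M :: "('a, 'b) fin_fun set"
  assumes nonempty: "M \<noteq> {}"
    and subset_fin_funs: "M \<subseteq> fin_funs A B"
    and minor_closed:
      "\<lbrakk>g \<in> M; n \<ge> 1; \<pi> \<in> {1..fst g} \<rightarrow> {1..n}\<rbrakk> \<Longrightarrow> minor A n \<pi> g \<in> M"

locale minion_hom = source: minion A B M + target: minion C D N
  for A :: "'a set" and B :: "'b set" and M :: "('a, 'b) fin_fun set"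
    and C :: "'c set" and D :: "'d set" and N :: "('c, 'd) fin_fun set" +
  fixes \<xi> :: "('a, 'b) fin_fun \<Rightarrow> ('c, 'd) fin_fun"
  assumes maps: "\<xi> \<in> M \<rightarrow> N"
    and preserves_arity: "g \<in> M \<Longrightarrow> fst (\<xi> g) = fst g"
    and preserves_minors:
      "\<lbrakk>g \<in> M; n \<ge> 1; \<pi> \<in> {1..fst g} \<rightarrow> {1..n}\<rbrakk> \<Longrightarrow> minor C n \<pi> (\<xi> g) = \<xi> (minor A n \<pi> g)"

section \<open>Graphs and polymorphisms\<close>

definition graph_hom :: "'a pair_pre_digraph \<Rightarrow> 'b pair_pre_digraph \<Rightarrow> ('a \<Rightarrow> 'b) set" where
  "graph_hom G H = {f \<in> pverts G \<rightarrow>\<^sub>E pverts H. \<forall>(u, v) \<in> parcs G. (f u, f v) \<in> parcs H}"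

definition graph_power :: "'a pair_pre_digraph \<Rightarrow> nat \<Rightarrow> 'a tuple pair_pre_digraph" where
  "graph_power G n =
    \<lparr>pverts = tuples n (pverts G),
     parcs = {(u, v). u \<in> tuples n (pverts G) \<and> v \<in> tuples n (pverts G) \<and>
                      (\<forall>i \<in> {1..n}. (u i, v i) \<in> parcs G)}\<rparr>"

definition Pol :: "'a pair_pre_digraph \<Rightarrow> 'b pair_pre_digraph \<Rightarrow> ('a, 'b) fin_fun set" where
  "Pol G H = {(n, f). n \<ge> 1 \<and> f \<in> graph_hom (graph_power G n) H}"

definition cycle_graph :: "nat \<Rightarrow> nat pair_pre_digraph" where
  "cycle_graph m =
    \<lparr>pverts = {..<m},
     parcs = {(u, v). u < m \<and> v < m \<and> ([u + 1 = v] (mod m) \<or> [v + 1 = u] (mod m))}\<rparr>"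

abbreviation K3 :: "nat pair_pre_digraph" where
  "K3 \<equiv> cycle_graph 3"

lemma pair_graph_cycle_graph:
  assumes "m \<ge> 3"
  shows "pair_graph (cycle_graph m)"
proof
  show "finite (parcs (cycle_graph m))"
    by (rule finite_subset[of _ "{..<m} \<times> {..<m}"]) (auto simp: cycle_graph_def)
  show "symmetric (with_proj (cycle_graph m))"
    by (auto simp: symmetric_def sym_def cycle_graph_def)
  fix e assume "e \<in> parcs (cycle_graph m)"
  then have "[fst e + 1 = fst e] (mod m)" if "fst e = snd e"
    using that by (auto simp: cycle_graph_def)
  then show "fst e \<noteq> snd e"
    using assms cong_add_lcancel_0_nat[of "fst e" 1 m] by (auto simp: cong_0_iff)
qed (auto simp: cycle_graph_def)

lemma K3_complete: "pverts K3 = {0, 1, 2}" "parcs K3 = {(u, v). u < 3 \<and> v < 3 \<and> u \<noteq> v}"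
proof -
  show "pverts K3 = {0, 1, 2}"
    by (auto simp: cycle_graph_def)
  have *: "(u, v) \<in> parcs K3 \<longleftrightarrow> u < 3 \<and> v < 3 \<and> u \<noteq> v" for u v
  proof (cases "u \<in> {0, 1, 2} \<and> v \<in> {0, 1, 2}")
    case True
    then show ?thesis
      by (elim conjE insertE emptyE; simp add: cycle_graph_def cong_def)
  next
    case False
    then have "\<not> u < 3 \<or> \<not> v < 3"
      by (simp, linarith)
    then show ?thesis
      by (auto simp: cycle_graph_def)
  qed
  show "parcs K3 = {(u, v). u < 3 \<and> v < 3 \<and> u \<noteq> v}"
    by (rule set_eqI, clarify) (simp add: *)
qed

section \<open>Linear functions with odd coefficient sum\<close>

definition Z_le :: "nat \<Rightarrow> (int, int) fin_fun set" where
  "Z_le N = {(n, \<lambda>x \<in> tuples n UNIV. \<Sum>i = 1..n. c i * x i) | n c.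
     n \<ge> 1 \<and> (\<Sum>i = 1..n. \<bar>c i\<bar>) \<le> int N \<and> odd (\<Sum>i = 1..n. c i)}"

end

theory Submission
  imports Defs
begin

text \<open>
  A colouring of \<open>\<^bold>C\<^sub>k\<^sup>n\<close> by \<open>\<^bold>K\<^sub>3\<close> lifts to a \<open>k\<close>-periodic colouring of \<open>\<int>\<^sup>n\<close>, where points differing by
  a sign vector \<open>a \<in> {1, -1}\<^sup>n\<close> get different colours. The closed walk with \<open>k\<close> steps \<open>a\<close> has a
  winding number \<open>d a\<close> around the triangle, which is odd and at most \<open>k / 3\<close> in absolute value.
  Every closed walk of length 4 has winding number 0, so \<open>d a + d b\<close> depends only on \<open>a + b\<close>;
  hence \<open>d a = (\<Sum>i. c i * a i)\<close> for integers \<open>c i\<close>. Taking \<open>a\<close> to be the signs of \<open>c\<close> gives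
  \<open>(\<Sum>i. \<bar>c i\<bar>) \<le> k / 3\<close>. Taking minors substitutes \<open>a \<circ> \<pi>\<close> for \<open>a\<close> in \<open>d\<close>, so sending the
  colouring to \<open>c\<close> is a minion homomorphism.
\<close>

section \<open>Turns of a 3-coloured walk around the triangle\<close>

definition turn :: "int \<Rightarrow> int \<Rightarrow> int" where
  "turn p q = (if (q - p) mod 3 = 1 then 1 else -1)"

lemma abs_turn [simp]: "\<bar>turn p q\<bar> = 1"
  by (simp add: turn_def)

lemma odd_turn [simp]: "odd (turn p q)"
  by (simp add: turn_def)

lemma dvd_turn:
  assumes "p \<in> {0, 1, 2}" "q \<in> {0, 1, 2}" "p \<noteq> q"
  shows "3 dvd q - p - turn p q"
  using assms by (auto simp: turn_def)

lemma turn_swap: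
  assumes "p \<in> {0, 1, 2}" "q \<in> {0, 1, 2}" "p \<noteq> q"
  shows "turn q p = - turn p q"
  using assms by (auto simp: turn_def)

text \<open>The total turn around a closed 4-walk is a multiple of 3 and, as a sum of four signs,
  even and at most 4 in absolute value; so it is 0.\<close>

lemma turn_square:
  assumes "p \<in> {0, 1, 2}" "q \<in> {0, 1, 2}" "r \<in> {0, 1, 2}" "s \<in> {0, 1, 2}"
    and "p \<noteq> q" "q \<noteq> r" "p \<noteq> s" "s \<noteq> r"
  shows "turn p q + turn q r = turn p s + turn s r"
  using assms by (auto simp: turn_def)

text \<open>The displacement, counted in edges, of the walk \<open>h \<circ> u\<close> lifted to the
  universal cover of the triangle.\<close>

definition walk_turn :: "('a \<Rightarrow> int) \<Rightarrow> (nat \<Rightarrow> 'a) \<Rightarrow> nat \<Rightarrow> int" where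
  "walk_turn h u m = (\<Sum>j<m. turn (h (u j)) (h (u (Suc j))))"

lemma walk_turn_0 [simp]: "walk_turn h u 0 = 0"
  by (simp add: walk_turn_def)

lemma walk_turn_Suc [simp]:
  "walk_turn h u (Suc m) = walk_turn h u m + turn (h (u m)) (h (u (Suc m)))"
  by (simp add: walk_turn_def)

section \<open>Winding numbers of periodic colourings\<close>

definition ray :: "(nat \<Rightarrow> int) \<Rightarrow> (nat \<Rightarrow> int) \<Rightarrow> nat \<Rightarrow> nat \<Rightarrow> int" where
  "ray x a j = (\<lambda>i. x i + int j * a i)"

definition sign_vec :: "nat set \<Rightarrow> nat \<Rightarrow> int" where
  "sign_vec S = (\<lambda>i. if i \<in> S then -1 else 1)"

lemma abs_sign_vec [simp]: "\<bar>sign_vec S i\<bar> = 1"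
  by (simp add: sign_vec_def)

definition winding :: "nat \<Rightarrow> ((nat \<Rightarrow> int) \<Rightarrow> int) \<Rightarrow> (nat \<Rightarrow> int) \<Rightarrow> int" where
  "winding k h a = walk_turn h (ray (\<lambda>_. 0) a) k div 3"

text \<open>Flipping the \<open>i\<close>-th sign changes a linear form in the signs by twice its
  \<open>i\<close>-th coefficient. For a periodic colouring both this division by 2 and the division
  by 3 in \<open>winding\<close> are exact.\<close>

definition winding_coeff :: "nat \<Rightarrow> ((nat \<Rightarrow> int) \<Rightarrow> int) \<Rightarrow> nat \<Rightarrow> int" where
  "winding_coeff k h i = (winding k h (sign_vec {}) - winding k h (sign_vec {i})) div 2"

text \<open>Points are total functions, so that vectors add without domain conditions;
  \<open>periodic\<close> makes \<open>h\<close> depend only on the coordinates in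
  \<open>{1..n}\<close>, modulo \<open>k\<close>.\<close>

locale periodic_colouring =
  fixes k n :: nat and h :: "(nat \<Rightarrow> int) \<Rightarrow> int"
  assumes odd_period: "odd k"
    and colours: "h x \<in> {0, 1, 2}"
    and proper: "(\<And>i. \<bar>a i\<bar> = 1) \<Longrightarrow> h x \<noteq> h (\<lambda>i. x i + a i)"
    and periodic: "(\<And>i. i \<in> {1..n} \<Longrightarrow> [x i = y i] (mod int k)) \<Longrightarrow> h x = h y"
begin

lemma proper_diff:
  assumes "\<And>i. \<bar>y i - x i\<bar> = 1"
  shows "h x \<noteq> h y"
  using proper[of "\<lambda>i. y i - x i" x] assms by simp

lemma square:
  assumes "\<And>i. \<bar>y i - x i\<bar> = 1" "\<And>i. \<bar>z i - y i\<bar> = 1" "\<And>i. \<bar>t i - x i\<bar> = 1" "\<And>i. \<bar>z i - t i\<bar> = 1"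
  shows "turn (h x) (h y) + turn (h y) (h z) = turn (h x) (h t) + turn (h t) (h z)"
  by (intro turn_square colours proper_diff assms)

text \<open>The two rays bound a ladder whose rungs are steps \<open>b\<close>; every square of the
  ladder has total turn 0, so the induction climbs rung by rung.\<close>

lemma walk_turn_ray_shift:
  assumes a: "\<And>i. \<bar>a i\<bar> = 1" and b: "\<And>i. \<bar>b i\<bar> = 1"
  shows "turn (h x) (h (\<lambda>i. x i + b i)) + walk_turn h (ray (\<lambda>i. x i + b i) a) m
    = walk_turn h (ray x a) m + turn (h (ray x a m)) (h (ray (\<lambda>i. x i + b i) a m))"
proof (induction m)
  case 0
  then show ?case by (simp add: ray_def)
next
  case (Suc m)
  have "turn (h (ray x a m)) (h (ray (\<lambda>i. x i + b i) a m))
      + turn (h (ray (\<lambda>i. x i + b i) a m)) (h (ray (\<lambda>i. x i + b i) a (Suc m)))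
    = turn (h (ray x a m)) (h (ray x a (Suc m)))
      + turn (h (ray x a (Suc m))) (h (ray (\<lambda>i. x i + b i) a (Suc m)))"
    by (rule square) (simp_all add: ray_def a b algebra_simps)
  with Suc show ?case by simp
qed

text \<open>Alternating the steps makes every second point depend only on \<open>a + b\<close>,
  unlike on two consecutive rays.\<close>

definition double_walk :: "(nat \<Rightarrow> int) \<Rightarrow> (nat \<Rightarrow> int) \<Rightarrow> nat \<Rightarrow> int" where
  "double_walk a b m = (\<Sum>j<m. let x = ray (\<lambda>_. 0) (\<lambda>i. a i + b i) j; y = (\<lambda>i. x i + a i); z = (\<lambda>i. y i + b i)
     in turn (h x) (h y) + turn (h y) (h z))"

text \<open>Exchanging adjacent steps \<open>a\<close> and \<open>b\<close> crosses a square, so the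
  alternating walk can be sorted into all steps \<open>a\<close>, then all steps \<open>b\<close>,
  at the same turn.\<close>

lemma double_walk_eq:
  assumes a: "\<And>i. \<bar>a i\<bar> = 1" and b: "\<And>i. \<bar>b i\<bar> = 1"
  shows "double_walk a b m = walk_turn h (ray (\<lambda>_. 0) a) m + walk_turn h (ray (ray (\<lambda>_. 0) a m) b) m"
proof (induction m)
  case 0
  then show ?case by (simp add: double_walk_def)
next
  case (Suc m)
  let ?o = "\<lambda>_. 0 :: int"
  have eq: "(\<lambda>i. ray ?o a m i + a i) = ray ?o a (Suc m)"
    "ray (ray ?o a m) b m = ray ?o (\<lambda>i. a i + b i) m"
    "ray (ray ?o a (Suc m)) b m = (\<lambda>i. ray ?o (\<lambda>i. a i + b i) m i + a i)"
    "ray (ray ?o a (Suc m)) b (Suc m) = (\<lambda>i. ray ?o (\<lambda>i. a i + b i) m i + a i + b i)"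
    by (auto simp: ray_def algebra_simps fun_eq_iff)
  show ?case
    \<comment> \<open>The shift lemma, with the roles of \<open>a\<close> and \<open>b\<close>
      exchanged, carries the new step \<open>a\<close> back across the \<open>m\<close> steps
      \<open>b\<close>.\<close>
    using walk_turn_ray_shift[of b a "ray ?o a m" m] a b Suc
    unfolding eq by (simp add: double_walk_def Let_def eq)
qed

text \<open>Only the midpoint of each double step depends on how the sum is split, and moving it
  crosses one square.\<close>

lemma double_walk_cong:
  assumes "\<And>i. \<bar>a i\<bar> = 1" "\<And>i. \<bar>b i\<bar> = 1" "\<And>i. \<bar>c i\<bar> = 1" "\<And>i. \<bar>d i\<bar> = 1"
    and sum: "\<And>i. a i + b i = c i + d i"
  shows "double_walk a b m = double_walk c d m"
  unfolding double_walk_def Let_def sum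
proof (rule sum.cong[OF refl])
  fix j
  let ?x = "ray (\<lambda>_. 0) (\<lambda>i. c i + d i) j"
  have "(\<lambda>i. ?x i + a i + b i) = (\<lambda>i. ?x i + c i + d i)"
    using sum by (simp add: add.assoc)
  moreover have "\<bar>?x i + c i + d i - (?x i + a i)\<bar> = 1" for i
    using sum[of i] assms(2)[of i] by linarith
  ultimately show "turn (h ?x) (h (\<lambda>i. ?x i + a i)) + turn (h (\<lambda>i. ?x i + a i)) (h (\<lambda>i. ?x i + a i + b i))
    = turn (h ?x) (h (\<lambda>i. ?x i + c i)) + turn (h (\<lambda>i. ?x i + c i)) (h (\<lambda>i. ?x i + c i + d i))"
    by (simp only:) (rule square; simp add: assms)
qed

lemma walk_turn_cong:
  assumes "\<And>j i. i \<in> {1..n} \<Longrightarrow> [u j i = v j i] (mod int k)"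
  shows "walk_turn h u m = walk_turn h v m"
  unfolding walk_turn_def using periodic assms by (metis (no_types, lifting))

lemma winding_cong:
  assumes "\<And>i. i \<in> {1..n} \<Longrightarrow> a i = b i"
  shows "winding k h a = winding k h b"
  unfolding winding_def using walk_turn_cong[of "ray (\<lambda>_. 0) a" "ray (\<lambda>_. 0) b"] assms
  by (simp add: ray_def)

text \<open>Each turn is congruent modulo 3 to a difference of colours, and these telescope.\<close>

lemma walk_turn_dvd:
  assumes a: "\<And>i. \<bar>a i\<bar> = 1"
  shows "3 dvd h (ray x a m) - h x - walk_turn h (ray x a) m"
proof (induction m)
  case 0
  then show ?case by (simp add: ray_def)
next
  case (Suc m)
  have "3 dvd h (ray x a (Suc m)) - h (ray x a m) - turn (h (ray x a m)) (h (ray x a (Suc m)))"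
    by (intro dvd_turn colours proper_diff) (simp add: ray_def a algebra_simps)
  from dvd_add[OF Suc this] show ?case by (simp add: algebra_simps)
qed

lemma winding_eq:
  assumes a: "\<And>i. \<bar>a i\<bar> = 1"
  shows "3 * winding k h a = walk_turn h (ray (\<lambda>_. 0) a) k"
proof -
  \<comment> \<open>After \<open>k\<close> steps the ray is at a point congruent to the origin, so
    the walk of colours closes.\<close>
  have "h (ray (\<lambda>_. 0) a k) = h (\<lambda>_. 0)"
    by (rule periodic) (simp add: ray_def cong_def)
  then show ?thesis
    using walk_turn_dvd[of a "\<lambda>_. 0" k] a by (simp add: winding_def)
qed

lemma odd_winding:
  assumes a: "\<And>i. \<bar>a i\<bar> = 1"
  shows "odd (winding k h a)"
proof -
  \<comment> \<open>A sum of \<open>m\<close> signs has the parity of \<open>m\<close>.\<close>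
  have "odd (walk_turn h u m) \<longleftrightarrow> odd m" for u m
    by (induction m) auto
  then have "odd (3 * winding k h a)"
    using winding_eq[of a] a odd_period by simp
  then show ?thesis by simp
qed

lemma winding_le:
  assumes a: "\<And>i. \<bar>a i\<bar> = 1"
  shows "3 * winding k h a \<le> int k"
proof -
  have "walk_turn h u m \<le> int m" for u m
  proof (induction m)
    case (Suc m)
    then show ?case using abs_turn[of "h (u m)" "h (u (Suc m))"] by (simp del: abs_turn)
  qed simp
  then show ?thesis using winding_eq[of a] a by simp
qed

lemma winding_add:
  assumes a: "\<And>i. \<bar>a i\<bar> = 1" and b: "\<And>i. \<bar>b i\<bar> = 1"
  shows "3 * (winding k h a + winding k h b) = double_walk a b k"
proof -
  \<comment> \<open>The second ray starts at \<open>k\<close> times \<open>a\<close>, which is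
    congruent to the origin.\<close>
  have "walk_turn h (ray (ray (\<lambda>_. 0) a k) b) k = walk_turn h (ray (\<lambda>_. 0) b) k"
    by (rule walk_turn_cong) (simp add: ray_def cong_def)
  then show ?thesis
    using double_walk_eq[of a b k] winding_eq[of a] winding_eq[of b] a b by simp
qed

lemma winding_add_cong:
  assumes "\<And>i. \<bar>a i\<bar> = 1" "\<And>i. \<bar>b i\<bar> = 1" "\<And>i. \<bar>c i\<bar> = 1" "\<And>i. \<bar>d i\<bar> = 1"
    and "\<And>i. a i + b i = c i + d i"
  shows "winding k h a + winding k h b = winding k h c + winding k h d"
  using winding_add[of a b] winding_add[of c d] double_walk_cong[of a b c d k] assms by simp

text \<open>Alternating \<open>a\<close> with its negative retraces every edge immediately, so all
  turns cancel.\<close>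

lemma winding_uminus:
  assumes a: "\<And>i. \<bar>a i\<bar> = 1"
  shows "winding k h a + winding k h (\<lambda>i. - a i) = 0"
proof -
  have "turn (h (\<lambda>i. x i + a i)) (h x) = - turn (h x) (h (\<lambda>i. x i + a i))" for x
    by (intro turn_swap colours proper a)
  then have "double_walk a (\<lambda>i. - a i) k = 0"
    by (simp add: double_walk_def Let_def)
  then show ?thesis
    using winding_add[of a "\<lambda>i. - a i"] a by simp
qed

lemma winding_coeff_eq:
  "2 * winding_coeff k h i = winding k h (sign_vec {}) - winding k h (sign_vec {i})"
  using odd_winding[of "sign_vec {}"] odd_winding[of "sign_vec {i}"] by (simp add: winding_coeff_def)

text \<open>For \<open>i\<close> outside \<open>S\<close>, the sign vectors of
  \<open>insert i S\<close> and \<open>{}\<close> have the same sum as those of \<open>S\<close> and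
  \<open>{i}\<close>, so each insertion lowers the winding number by twice the coefficient of
  \<open>i\<close>.\<close>

lemma winding_sign_vec_diff:
  assumes "finite S"
  shows "winding k h (sign_vec {}) - winding k h (sign_vec S) = 2 * (\<Sum>i\<in>S. winding_coeff k h i)"
  using assms
proof (induction S)
  case empty
  then show ?case by simp
next
  case (insert i S)
  have "winding k h (sign_vec (insert i S)) + winding k h (sign_vec {})
      = winding k h (sign_vec S) + winding k h (sign_vec {i})"
    using insert.hyps by (intro winding_add_cong) (auto simp: sign_vec_def)
  then show ?case
    using insert winding_coeff_eq[of i] by simp
qed

text \<open>The differences fix the winding number only up to a constant; antisymmetry under
  negation of the vector makes that constant vanish.\<close>

lemma winding_ones: "winding k h (sign_vec {}) = (\<Sum>i=1..n. winding_coeff k h i)"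
proof -
  have "winding k h (sign_vec {1..n}) = winding k h (\<lambda>i. - sign_vec {} i)"
    by (rule winding_cong) (simp add: sign_vec_def)
  then show ?thesis
    using winding_sign_vec_diff[of "{1..n}"] winding_uminus[of "sign_vec {}"] by simp
qed

lemma odd_sum_winding_coeff: "odd (\<Sum>i=1..n. winding_coeff k h i)"
  using odd_winding[of "sign_vec {}"] winding_ones by simp

text \<open>The signs of the coefficients, used as step vector, turn the linear form into the sum of
  absolute values; the bound on winding numbers then bounds that sum.\<close>

lemma sum_abs_winding_coeff:
  obtains a where "\<And>i. \<bar>a i\<bar> = 1" "(\<Sum>i=1..n. \<bar>winding_coeff k h i\<bar>) = winding k h a"
proof -
  define S where "S = {i \<in> {1..n}. winding_coeff k h i < 0}"
  have "(\<Sum>i=1..n. \<bar>winding_coeff k h i\<bar>)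
      = (\<Sum>i=1..n. winding_coeff k h i - (if i \<in> S then 2 * winding_coeff k h i else 0))"
    by (rule sum.cong) (auto simp: S_def)
  also have "\<dots> = winding k h (sign_vec {}) - 2 * (\<Sum>i\<in>S. winding_coeff k h i)"
    by (simp add: sum_subtractf winding_ones S_def sum_distrib_left flip: sum.inter_restrict sum.inter_filter)
  also have "\<dots> = winding k h (sign_vec S)"
    using winding_sign_vec_diff[of S] by (simp add: S_def)
  finally show ?thesis using that[of "sign_vec S"] by simp
qed

end

section \<open>Lifting polymorphisms to periodic colourings\<close>

definition torus_lift :: "nat \<Rightarrow> (nat, nat) fin_fun \<Rightarrow> (nat \<Rightarrow> int) \<Rightarrow> int" where
  "torus_lift k g x = int (snd g (\<lambda>i\<in>{1..fst g}. nat (x i mod int k)))"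

lemma pverts_cycle_graph: "pverts (cycle_graph m) = {..<m}"
  by (simp add: cycle_graph_def)

lemma cycle_graph_arc_iff:
  assumes "k \<ge> 3"
  shows "(nat (x mod int k), nat (y mod int k)) \<in> parcs (cycle_graph k)
    \<longleftrightarrow> [x + 1 = y] (mod int k) \<or> [y + 1 = x] (mod int k)"
proof -
  have "[nat (x mod int k) + 1 = nat (y mod int k)] (mod k) \<longleftrightarrow> [x + 1 = y] (mod int k)" for x y
  proof -
    have "[nat (x mod int k) + 1 = nat (y mod int k)] (mod k)
      \<longleftrightarrow> [x mod int k + 1 = y mod int k] (mod int k)"
      using assms by (simp flip: cong_int_iff add: nat_mod_distrib add.commute)
    then show ?thesis by (simp add: cong_def mod_simps)
  qed
  moreover have "nat (z mod int k) < k" for z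
    using assms by (simp add: nat_less_iff)
  ultimately show ?thesis by (simp add: cycle_graph_def)
qed

text \<open>After reduction modulo \<open>k\<close>, adding a sign vector moves every coordinate
  along an arc of the cycle, so the homomorphism property gives properness.\<close>

lemma periodic_colouring_torus_lift:
  assumes k: "k \<ge> 3" "odd k" and g: "g \<in> Pol (cycle_graph k) K3"
  shows "periodic_colouring k (fst g) (torus_lift k g)"
proof -
  obtain n f where nf: "g = (n, f)" by force
  let ?r = "\<lambda>x. \<lambda>i\<in>{1..n}. nat (x i mod int k)"
  have f: "f \<in> tuples n {..<k} \<rightarrow>\<^sub>E {0, 1, 2}"
    using g unfolding nf Pol_def graph_hom_def K3_complete(1) by (auto simp: graph_power_def pverts_cycle_graph)
  have hom: "\<And>u v. (u, v) \<in> parcs (graph_power (cycle_graph k) n) \<Longrightarrow> f u \<noteq> f v"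
    using g by (auto simp: nf Pol_def graph_hom_def K3_complete)
  have r: "?r x \<in> tuples n {..<k}" for x
    using k by (auto simp: tuples_def nat_less_iff)
  show ?thesis
  proof
    show "torus_lift k g x \<in> {0, 1, 2}" for x
      using PiE_mem[OF f r[of x]] by (auto simp: torus_lift_def nf)
    show "torus_lift k g x \<noteq> torus_lift k g (\<lambda>i. x i + a i)" if "\<And>i. \<bar>a i\<bar> = 1" for a x
    proof -
      have "(nat (x i mod int k), nat ((x i + a i) mod int k)) \<in> parcs (cycle_graph k)" for i
      proof -
        have "a i = 1 \<or> a i = -1" using that[of i] by linarith
        then show ?thesis unfolding cycle_graph_arc_iff[OF k(1)] by auto
      qed
      then have "(?r x, ?r (\<lambda>i. x i + a i)) \<in> parcs (graph_power (cycle_graph k) n)"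
        using r by (simp add: graph_power_def cycle_graph_def)
      from hom[OF this] show ?thesis by (simp add: torus_lift_def nf)
    qed
    show "torus_lift k g x = torus_lift k g y"
      if "\<And>i. i \<in> {1..fst g} \<Longrightarrow> [x i = y i] (mod int k)" for x y
    proof -
      have "?r x = ?r y" using that by (auto simp: nf cong_def)
      then show ?thesis by (simp add: torus_lift_def nf)
    qed
  qed (use k in auto)
qed

lemma torus_lift_minor:
  assumes "k \<ge> 3" "\<pi> \<in> {1..fst g} \<rightarrow> {1..n}"
  shows "torus_lift k (minor {..<k} n \<pi> g) x = torus_lift k g (x \<circ> \<pi>)"
proof -
  have "(\<lambda>i\<in>{1..n}. nat (x i mod int k)) \<in> tuples n {..<k}"
    using assms by (auto simp: tuples_def nat_less_iff)
  moreover have "(\<lambda>i\<in>{1..fst g}. (\<lambda>i\<in>{1..n}. nat (x i mod int k)) (\<pi> i))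
      = (\<lambda>i\<in>{1..fst g}. nat (x (\<pi> i) mod int k))"
    using assms by (auto simp: fun_eq_iff)
  ultimately show ?thesis by (simp add: torus_lift_def minor_def)
qed

text \<open>Precomposing with \<open>\<pi>\<close> takes the ray of \<open>a\<close> to the ray of
  \<open>a \<circ> \<pi>\<close>, so both sides read off the same colours.\<close>

lemma winding_torus_lift_minor:
  assumes "k \<ge> 3" "\<pi> \<in> {1..fst g} \<rightarrow> {1..n}"
  shows "winding k (torus_lift k (minor {..<k} n \<pi> g)) a = winding k (torus_lift k g) (a \<circ> \<pi>)"
  using assms by (simp add: winding_def walk_turn_def torus_lift_minor ray_def comp_def)

section \<open>The minion of polymorphisms\<close>

lemma minion_Pol_cycle_K3:
  assumes "k \<ge> 3" "odd k"
  shows "minion (pverts (cycle_graph k)) (pverts K3) (Pol (cycle_graph k) K3)"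
proof
  \<comment> \<open>A proper 3-colouring of the odd cycle: 0 and 1 alternate, and the last vertex
    gets 2 because its parity would repeat the colour of vertex 0.\<close>
  let ?c = "\<lambda>v::nat. if v = k - 1 then 2 else v mod 2"
  have c: "?c u \<noteq> ?c v" if "u < k" "v < k" "[u + 1 = v] (mod k)" for u v
  proof (cases "u + 1 = k")
    case True
    with that have "v = 0" by (simp add: cong_def)
    with True assms show ?thesis by auto
  next
    case False
    with that have "v = u + 1" by (simp add: cong_def)
    with False assms show ?thesis by (auto; presburger)
  qed
  have "(1, \<lambda>x\<in>tuples 1 {..<k}. ?c (x 1)) \<in> Pol (cycle_graph k) K3"
  proof -
    have "?c (u 1) \<noteq> ?c (v 1)"
      if "(u, v) \<in> parcs (graph_power (cycle_graph k) 1)" for u v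
      using that c[of "u 1" "v 1"] c[of "v 1" "u 1"]
      by (auto simp: graph_power_def cycle_graph_def)
    moreover have "?c v < 3" for v
      by (simp, linarith)
    ultimately show ?thesis
      unfolding Pol_def graph_hom_def K3_complete(2)
      by (auto simp: graph_power_def cycle_graph_def)
  qed
  then show "Pol (cycle_graph k) K3 \<noteq> {}" by blast
  show "Pol (cycle_graph k) K3 \<subseteq> fin_funs (pverts (cycle_graph k)) (pverts K3)"
    by (auto simp: Pol_def fin_funs_def graph_hom_def graph_power_def)
  fix g and n :: nat and \<pi>
  assume g: "g \<in> Pol (cycle_graph k) K3" and n: "n \<ge> 1" and p: "\<pi> \<in> {1..fst g} \<rightarrow> {1..n}"
  obtain m f where mf: "g = (m, f)" by force
  \<comment> \<open>Reindexing by \<open>\<pi>\<close> is a homomorphism from the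
    \<open>n\<close>-th to the \<open>m\<close>-th power, so composing it with \<open>f\<close>
    gives a polymorphism.\<close>
  let ?s = "\<lambda>x. \<lambda>i\<in>{1..m}. x (\<pi> i)"
  have p: "\<pi> \<in> {1..m} \<rightarrow> {1..n}" using p mf by simp
  have f: "f \<in> tuples m {..<k} \<rightarrow>\<^sub>E pverts K3"
    and hom: "\<And>u v. (u, v) \<in> parcs (graph_power (cycle_graph k) m) \<Longrightarrow> (f u, f v) \<in> parcs K3"
    using g unfolding mf Pol_def graph_hom_def by (auto simp: graph_power_def pverts_cycle_graph[of k])
  have s: "?s x \<in> tuples m {..<k}" if "x \<in> tuples n {..<k}" for x
    using that p by (auto simp: tuples_def)
  have fs: "f (?s x) \<in> pverts K3" if "x \<in> tuples n {..<k}" for x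
    using f s[OF that] by (rule PiE_mem)
  have "(f (?s u), f (?s v)) \<in> parcs K3"
    if "(u, v) \<in> parcs (graph_power (cycle_graph k) n)" for u v
  proof (rule hom)
    show "(?s u, ?s v) \<in> parcs (graph_power (cycle_graph k) m)"
      using that p s by (auto simp: graph_power_def pverts_cycle_graph)
  qed
  moreover have "u \<in> tuples n {..<k}" "v \<in> tuples n {..<k}"
    if "(u, v) \<in> parcs (graph_power (cycle_graph k) n)" for u v
    using that by (auto simp: graph_power_def pverts_cycle_graph)
  moreover have "pverts (graph_power (cycle_graph k) n) = tuples n {..<k}"
    by (simp add: graph_power_def pverts_cycle_graph)
  ultimately have "(\<lambda>x\<in>tuples n {..<k}. f (?s x)) \<in> graph_hom (graph_power (cycle_graph k) n) K3"
    using fs unfolding graph_hom_def by auto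
  then show "minor (pverts (cycle_graph k)) n \<pi> g \<in> Pol (cycle_graph k) K3"
    using n by (simp add: minor_def Pol_def mf pverts_cycle_graph)
qed

section \<open>The minion of linear functions\<close>

lemma sum_fibres:
  fixes c :: "'a \<Rightarrow> 'c :: comm_semiring_0"
  assumes "finite A" "finite B" "\<pi> \<in> A \<rightarrow> B"
  shows "(\<Sum>i\<in>B. (\<Sum>j | j \<in> A \<and> \<pi> j = i. c j) * x i) = (\<Sum>j\<in>A. c j * x (\<pi> j))"
proof -
  have "(\<Sum>j\<in>A. c j * x (\<pi> j)) = (\<Sum>i\<in>B. \<Sum>j | j \<in> A \<and> \<pi> j = i. c j * x (\<pi> j))"
    using assms by (intro sum.group[symmetric]) auto
  then show ?thesis by (simp add: sum_distrib_right)
qed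

definition linear_fun :: "nat \<Rightarrow> (nat \<Rightarrow> int) \<Rightarrow> (int, int) fin_fun" where
  "linear_fun n c = (n, \<lambda>x\<in>tuples n UNIV. \<Sum>i=1..n. c i * x i)"

lemma linear_fun_cong: "(\<And>i. i \<in> {1..n} \<Longrightarrow> c i = d i) \<Longrightarrow> linear_fun n c = linear_fun n d"
  by (simp add: linear_fun_def)

lemma linear_fun_in_Z_le:
  assumes "n \<ge> 1" "(\<Sum>i=1..n. \<bar>c i\<bar>) \<le> int N" "odd (\<Sum>i=1..n. c i)"
  shows "linear_fun n c \<in> Z_le N"
  using assms unfolding linear_fun_def Z_le_def by blast

lemma Z_leE:
  assumes "g \<in> Z_le N"
  obtains n c where "g = linear_fun n c" "n \<ge> 1" "(\<Sum>i=1..n. \<bar>c i\<bar>) \<le> int N" "odd (\<Sum>i=1..n. c i)"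
  using assms unfolding linear_fun_def Z_le_def by blast

lemma minor_linear_fun:
  assumes "\<pi> \<in> {1..m} \<rightarrow> {1..n}"
  shows "minor UNIV n \<pi> (linear_fun m c) = linear_fun n (\<lambda>i. \<Sum>j | j \<in> {1..m} \<and> \<pi> j = i. c j)"
proof -
  have "(\<lambda>i\<in>{1..m}. x (\<pi> i)) \<in> tuples m UNIV" for x :: "nat \<Rightarrow> int"
    by (simp add: tuples_def)
  then show ?thesis
    using sum_fibres[of "{1..m}" "{1..n}" \<pi> c] assms
    by (simp add: linear_fun_def minor_def)
qed

lemma minion_Z_le:
  assumes "N \<ge> 1"
  shows "minion UNIV UNIV (Z_le N)"
proof
  \<comment> \<open>The unary identity has coefficient sum 1, within the bound since
    \<open>N \<ge> 1\<close>.\<close>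
  have "linear_fun 1 (\<lambda>_. 1) \<in> Z_le N"
    using assms by (intro linear_fun_in_Z_le) auto
  then show "Z_le N \<noteq> {}" by blast
  show "Z_le N \<subseteq> fin_funs UNIV UNIV"
    by (auto simp: Z_le_def fin_funs_def)
  fix g and n :: nat and \<pi>
  assume g: "g \<in> Z_le N" and n: "n \<ge> 1" and p: "\<pi> \<in> {1..fst g} \<rightarrow> {1..n}"
  obtain m c where c: "g = linear_fun m c" "(\<Sum>i=1..m. \<bar>c i\<bar>) \<le> int N" "odd (\<Sum>i=1..m. c i)"
    using g by (rule Z_leE)
  have p: "\<pi> \<in> {1..m} \<rightarrow> {1..n}" using p c(1) by (simp add: linear_fun_def)
  let ?d = "\<lambda>i. \<Sum>j | j \<in> {1..m} \<and> \<pi> j = i. c j"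
  \<comment> \<open>Identifying variables adds up the coefficients in each fibre, so the triangle
    inequality keeps the bound.\<close>
  have "(\<Sum>i=1..n. \<bar>?d i\<bar>) \<le> (\<Sum>i=1..n. \<Sum>j | j \<in> {1..m} \<and> \<pi> j = i. \<bar>c j\<bar>)"
    by (intro sum_mono sum_abs)
  also have "\<dots> = (\<Sum>i=1..m. \<bar>c i\<bar>)"
    using sum_fibres[OF _ _ p, of "\<lambda>j. \<bar>c j\<bar>" "\<lambda>_. 1"] by simp
  finally have "(\<Sum>i=1..n. \<bar>?d i\<bar>) \<le> int N" using c(2) by simp
  moreover have "(\<Sum>i=1..n. ?d i) = (\<Sum>i=1..m. c i)"
    using sum_fibres[OF _ _ p, of c "\<lambda>_. 1"] by simp
  ultimately show "minor UNIV n \<pi> g \<in> Z_le N"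
    unfolding c(1) minor_linear_fun[OF p] using n c(3) by (intro linear_fun_in_Z_le) simp_all
qed

section \<open>The minion homomorphism\<close>

lemma winding_coeff_minor:
  assumes k: "k \<ge> 3" "odd k" and g: "g \<in> Pol (cycle_graph k) K3"
    and p: "\<pi> \<in> {1..fst g} \<rightarrow> {1..n}"
  shows "winding_coeff k (torus_lift k (minor {..<k} n \<pi> g)) i
    = (\<Sum>j | j \<in> {1..fst g} \<and> \<pi> j = i. winding_coeff k (torus_lift k g) j)"
proof -
  interpret periodic_colouring k "fst g" "torus_lift k g"
    using k g by (rule periodic_colouring_torus_lift)
  let ?S = "{j. j \<in> {1..fst g} \<and> \<pi> j = i}"
  \<comment> \<open>Within \<open>{1..fst g}\<close> the pulled-back vector is -1 exactly on the
    fibre \<open>?S\<close>, so passing to it from the all-ones vector lowers the winding number by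
    twice the sum of the coefficients over the fibre.\<close>
  have "winding k (torus_lift k g) (sign_vec {i} \<circ> \<pi>) = winding k (torus_lift k g) (sign_vec ?S)"
    by (rule winding_cong) (simp add: sign_vec_def)
  moreover have "sign_vec {} \<circ> \<pi> = sign_vec {}"
    by (simp add: sign_vec_def comp_def)
  moreover have "winding k (torus_lift k g) (sign_vec {}) - winding k (torus_lift k g) (sign_vec ?S)
      = 2 * (\<Sum>j\<in>?S. winding_coeff k (torus_lift k g) j)"
    by (rule winding_sign_vec_diff) simp
  ultimately show ?thesis
    unfolding winding_coeff_def[of k "torus_lift k (minor {..<k} n \<pi> g)"] 
      winding_torus_lift_minor[OF k(1) p] by simp
qed

theorem theorem3p3:
  fixes k N :: nat
  assumes "k \<ge> 3" and "odd k"
    and "N = (GREATEST m. odd m \<and> real m \<le> real k / 3)"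
  shows "\<exists>\<xi>. minion_hom (pverts (cycle_graph k)) (pverts K3) (Pol (cycle_graph k) K3)
                        (UNIV :: int set) (UNIV :: int set) (Z_le N) \<xi>"
proof -
  \<comment> \<open>Every admissible \<open>m\<close> is at most \<open>k\<close>, so the greatest
    one exists.\<close>
  have N_greatest: "m \<le> N" if "odd m" "3 * m \<le> k" for m
    unfolding assms(3) using that by (intro Greatest_le_nat[where b = k]) auto
  define \<xi> where "\<xi> g = linear_fun (fst g) (winding_coeff k (torus_lift k g))" for g
  have "minion_hom (pverts (cycle_graph k)) (pverts K3) (Pol (cycle_graph k) K3) UNIV UNIV (Z_le N) \<xi>"
  proof (intro minion_hom.intro minion_hom_axioms.intro)
    show "minion (pverts (cycle_graph k)) (pverts K3) (Pol (cycle_graph k) K3)"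
      using assms(1,2) by (rule minion_Pol_cycle_K3)
    show "minion UNIV UNIV (Z_le N)"
      \<comment> \<open>The number 1 is admissible because \<open>k \<ge> 3\<close>.\<close>
      using N_greatest[of 1] assms(1) by (intro minion_Z_le) simp
    show "\<xi> \<in> Pol (cycle_graph k) K3 \<rightarrow> Z_le N"
    proof
      fix g assume g: "g \<in> Pol (cycle_graph k) K3"
      interpret periodic_colouring k "fst g" "torus_lift k g"
        using assms(1,2) g by (rule periodic_colouring_torus_lift)
      obtain a where a: "\<And>i. \<bar>a i\<bar> = 1" and
        sum: "(\<Sum>i=1..fst g. \<bar>winding_coeff k (torus_lift k g) i\<bar>) = winding k (torus_lift k g) a"
        by (rule sum_abs_winding_coeff) blast
      \<comment> \<open>As a sum of absolute values this winding number is nonnegative, hence an odd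
        natural number \<open>m\<close> with \<open>3 * m \<le> k\<close>, and maximality of
        \<open>N\<close> applies.\<close>
      define m where "m = nat (winding k (torus_lift k g) a)"
      have m: "winding k (torus_lift k g) a = int m"
        unfolding m_def sum[symmetric] by (simp add: sum_nonneg)
      have "m \<le> N"
        using odd_winding[of a] winding_le[of a] a m by (intro N_greatest) simp_all
      moreover have "fst g \<ge> 1" using g by (auto simp: Pol_def)
      ultimately show "\<xi> g \<in> Z_le N"
        unfolding \<xi>_def using sum m odd_sum_winding_coeff by (intro linear_fun_in_Z_le) simp_all
    qed
    show "fst (\<xi> g) = fst g" for g
      by (simp add: \<xi>_def linear_fun_def)
    show "minor UNIV n \<pi> (\<xi> g) = \<xi> (minor (pverts (cycle_graph k)) n \<pi> g)"
      if "g \<in> Pol (cycle_graph k) K3" "n \<ge> 1" "\<pi> \<in> {1..fst g} \<rightarrow> {1..n}" for g n \<pi>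
    proof -
      have "fst (minor {..<k} n \<pi> g) = n" by (simp add: minor_def)
      then show ?thesis
        unfolding \<xi>_def pverts_cycle_graph minor_linear_fun[OF that(3)]
        by (simp only:) (rule linear_fun_cong, rule winding_coeff_minor[OF assms(1,2) that(1,3), symmetric])
    qed
  qed
  then show ?thesis by blast
qed

end
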